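(* Let $\mathcal{B}$ and $\mathcal{E}$ be unital C*-algebras and let $\pi:\mathcal{B}\to\mathcal{E}$ be a unital surjective $*$-homomorphism. If $\mathcal{S}\subseteq\mathcal{B}$, then $$\pi\left(\mathrm{Appr}(\mathcal{S},\mathcal{B})''\right)\subseteq \mathrm{Appr}(\pi(\mathcal{S}),\mathcal{E})''.$$
   Context: For a unital C*-algebra $\mathcal{B}$ and a subset $\mathcal{S}\subseteq\mathcal{B}$, the relative approximate double commutant $\mathrm{Appr}(\mathcal{S},\mathcal{B})''$ is the set of all $T\in\mathcal{B}$ such that $\|TA_\lambda-A_\lambda T\|\to 0$ for every bounded net $\{A_\lambda\}$ in $\mathcal{B}$ for which $\|SA_\lambda-A_\lambda S\|\to 0$ for every $S\in\mathcal{S}$. *)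

theory Defs
  imports "HOL-Analysis.Analysis"
begin

text \<open>
  Unital complex C*-algebras as a type class. The base classes provide the real Banach algebra
  structure and a unit; \<open>scaleC\<close> extends the real scaling to the complex numbers.
  The class \<open>ring_1\<close> (and hence \<open>real_normed_algebra_1\<close>) is deliberately not used: it
  requires \<open>0 \<noteq> 1\<close> and would exclude the zero algebra. If \<open>0 \<noteq> 1\<close>, then \<open>norm 1 = 1\<close> follows
  from the C*-identity.
\<close>

class unital_cstar_algebra = real_normed_algebra + banach + monoid_mult +
  fixes scaleC :: "complex \<Rightarrow> 'a \<Rightarrow> 'a"
    and adj :: "'a \<Rightarrow> 'a"
  assumes scaleC_add_right: "scaleC c (x + y) = scaleC c x + scaleC c y"
    and scaleC_add_left: "scaleC (c + d) x = scaleC c x + scaleC d x"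
    and scaleC_scaleC: "scaleC c (scaleC d x) = scaleC (c * d) x"
    and scaleC_of_real: "scaleC (complex_of_real r) x = r *\<^sub>R x"
    and mult_scaleC_left: "scaleC c x * y = scaleC c (x * y)"
    and mult_scaleC_right: "x * scaleC c y = scaleC c (x * y)"
    and norm_scaleC: "norm (scaleC c x) = cmod c * norm x"
    and adj_adj: "adj (adj x) = x"
    and adj_add: "adj (x + y) = adj x + adj y"
    and adj_scaleC: "adj (scaleC c x) = scaleC (cnj c) (adj x)"
    and adj_mult: "adj (x * y) = adj y * adj x"
    and cstar_identity: "norm (adj x * x) = norm x ^ 2"

definition unital_star_hom ::
    "('b::unital_cstar_algebra \<Rightarrow> 'e::unital_cstar_algebra) \<Rightarrow> bool" where
  "unital_star_hom f \<longleftrightarrow>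
     (\<forall>x y. f (x + y) = f x + f y) \<and>
     (\<forall>c x. f (scaleC c x) = scaleC c (f x)) \<and>
     (\<forall>x y. f (x * y) = f x * f y) \<and>
     (\<forall>x. f (adj x) = adj (f x)) \<and>
     f 1 = 1"

definition directed_set :: "'i set \<Rightarrow> ('i \<Rightarrow> 'i \<Rightarrow> bool) \<Rightarrow> bool" where
  "directed_set I le \<longleftrightarrow>
     I \<noteq> {} \<and>
     (\<forall>i\<in>I. le i i) \<and>
     (\<forall>i\<in>I. \<forall>j\<in>I. \<forall>k\<in>I. le i j \<longrightarrow> le j k \<longrightarrow> le i k) \<and>
     (\<forall>i\<in>I. \<forall>j\<in>I. \<exists>k\<in>I. le i k \<and> le j k)"

text \<open>
  The filter of tails of a directed set, so that \<open>(A \<longlongrightarrow> l) (tails I le)\<close> is convergence of the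
  net \<open>A\<close> indexed by \<open>I\<close>; see \<open>eventually_tails\<close> and \<open>tendsto_zero_tails\<close> below.
\<close>

definition tails :: "'i set \<Rightarrow> ('i \<Rightarrow> 'i \<Rightarrow> bool) \<Rightarrow> 'i filter" where
  "tails I le = (INF i\<in>I. principal {j \<in> I. le i j})"

text \<open>
  Nets may have arbitrary directed index sets, but a definition cannot quantify over the index
  type. The index sets below are therefore subsets of the type \<open>'a set \<times> 'a\<close>. This is no
  restriction: \<open>approx_double_commutant_net\<close> below shows that the defining property then
  holds for nets over directed sets in any type.
\<close>

definition approx_double_commutant :: "'a::unital_cstar_algebra set \<Rightarrow> 'a set" where
  "approx_double_commutant S =
     {T. \<forall>(I :: ('a set \<times> 'a) set) le A.
           directed_set I le \<longrightarrow>
           bounded (A ` I) \<longrightarrow>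
           (\<forall>s\<in>S. ((\<lambda>i. norm (s * A i - A i * s)) \<longlongrightarrow> 0) (tails I le)) \<longrightarrow>
           ((\<lambda>i. norm (T * A i - A i * T)) \<longlongrightarrow> 0) (tails I le)}"

lemma eventually_tails:
  assumes "directed_set I le"
  shows "eventually P (tails I le) \<longleftrightarrow> (\<exists>i\<in>I. \<forall>j\<in>I. le i j \<longrightarrow> P j)"
proof -
  have "eventually P (tails I le) \<longleftrightarrow> (\<exists>i\<in>I. eventually P (principal {j \<in> I. le i j}))"
    unfolding tails_def
  proof (rule eventually_INF_base)
    show "I \<noteq> {}"
      using assms by (simp add: directed_set_def)
    fix i j
    assume ij: "i \<in> I" "j \<in> I"
    then obtain k where k: "k \<in> I" "le i k" "le j k"
      using assms unfolding directed_set_def by blast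
    have "le i l \<and> le j l" if "l \<in> I" "le k l" for l
      using assms ij k that unfolding directed_set_def by blast
    then show "\<exists>k\<in>I. principal {l \<in> I. le k l}
        \<le> inf (principal {l \<in> I. le i l}) (principal {l \<in> I. le j l})"
      using k(1) by (intro bexI[of _ k]) auto
  qed
  then show ?thesis
    by (auto simp: eventually_principal)
qed

lemma tendsto_zero_tails:
  fixes f :: "'i \<Rightarrow> real"
  assumes "directed_set I le"
  shows "(f \<longlongrightarrow> 0) (tails I le) \<longleftrightarrow> (\<forall>e>0. \<exists>i\<in>I. \<forall>j\<in>I. le i j \<longrightarrow> \<bar>f j\<bar> < e)"
  by (simp add: tendsto_iff eventually_tails[OF assms])

lemma approx_double_commutant_net:
  fixes S :: "'a::unital_cstar_algebra set" and I :: "'i set" and A :: "'i \<Rightarrow> 'a"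
  assumes T: "T \<in> approx_double_commutant S"
    and dir: "directed_set I le"
    and bdd: "bounded (A ` I)"
    and lim: "\<And>s. s \<in> S \<Longrightarrow> ((\<lambda>i. norm (s * A i - A i * s)) \<longlongrightarrow> 0) (tails I le)"
  shows "((\<lambda>i. norm (T * A i - A i * T)) \<longlongrightarrow> 0) (tails I le)"
proof -
  define U where "U i = A ` {j \<in> I. le i j}" for i
  define J where "J = (SIGMA V:U ` I. V)"
  define le' :: "'a set \<times> 'a \<Rightarrow> 'a set \<times> 'a \<Rightarrow> bool" where "le' p q \<longleftrightarrow> fst q \<subseteq> fst p" for p q
  have U_mono: "U j \<subseteq> U i" if "i \<in> I" "j \<in> I" "le i j" for i j
    using dir that unfolding U_def directed_set_def by blast
  have U_self: "A i \<in> U i" if "i \<in> I" for i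
    using dir that unfolding U_def directed_set_def by blast
  have dirJ: "directed_set J le'"
    unfolding directed_set_def
  proof (intro conjI ballI impI)
    show "J \<noteq> {}"
      using dir U_self unfolding J_def directed_set_def by blast
    fix p q
    assume "p \<in> J" "q \<in> J"
    then obtain i j where ij: "i \<in> I" "j \<in> I" "fst p = U i" "fst q = U j"
      unfolding J_def by auto
    then obtain k where k: "k \<in> I" "le i k" "le j k"
      using dir unfolding directed_set_def by blast
    then have "(U k, A k) \<in> J"
      using U_self by (auto simp: J_def)
    then show "\<exists>r\<in>J. le' p r \<and> le' q r"
      using U_mono ij k unfolding le'_def by (intro bexI[of _ "(U k, A k)"]) auto
  qed (auto simp: le'_def)
  have ev: "eventually (\<lambda>p. P (snd p)) (tails J le') \<longleftrightarrow> eventually (\<lambda>i. P (A i)) (tails I le)"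
    for P
  proof -
    have "(\<exists>p\<in>J. \<forall>q\<in>J. le' p q \<longrightarrow> P (snd q)) \<longleftrightarrow> (\<exists>i\<in>I. \<forall>x\<in>U i. P x)"
    proof
      assume "\<exists>p\<in>J. \<forall>q\<in>J. le' p q \<longrightarrow> P (snd q)"
      then obtain i x where "i \<in> I" "\<forall>q\<in>J. le' (U i, x) q \<longrightarrow> P (snd q)"
        unfolding J_def by auto
      then show "\<exists>i\<in>I. \<forall>x\<in>U i. P x"
        by (intro bexI[of _ i]) (force simp: J_def le'_def)+
    next
      assume "\<exists>i\<in>I. \<forall>x\<in>U i. P x"
      then obtain i where "i \<in> I" "\<forall>x\<in>U i. P x"
        by blast
      then show "\<exists>p\<in>J. \<forall>q\<in>J. le' p q \<longrightarrow> P (snd q)"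
        using U_self by (intro bexI[of _ "(U i, A i)"]) (auto simp: J_def le'_def)
    qed
    then show ?thesis
      by (auto simp: eventually_tails[OF dirJ] eventually_tails[OF dir] U_def)
  qed
  have tend: "((\<lambda>p. g (snd p)) \<longlongrightarrow> 0) (tails J le') \<longleftrightarrow> ((\<lambda>i. g (A i)) \<longlongrightarrow> 0) (tails I le)"
    for g :: "'a \<Rightarrow> real"
    unfolding tendsto_iff using ev[of "\<lambda>x. dist (g x) 0 < _"] by simp
  have "snd ` J \<subseteq> A ` I"
    by (auto simp: J_def U_def)
  then have "bounded (snd ` J)"
    using bdd bounded_subset by blast
  moreover have "\<forall>s\<in>S. ((\<lambda>p. norm (s * snd p - snd p * s)) \<longlongrightarrow> 0) (tails J le')"
    using lim tend[of "\<lambda>x. norm (_ * x - x * _)"] by blast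
  ultimately have "((\<lambda>p. norm (T * snd p - snd p * T)) \<longlongrightarrow> 0) (tails J le')"
    using T dirJ unfolding approx_double_commutant_def by blast
  then show ?thesis
    using tend[of "\<lambda>x. norm (T * x - x * T)"] by blast
qed

end

theory Submission
  imports Defs
begin

text \<open>
  Membership of \<open>T\<close> in the approximate double commutant of \<open>S\<close> is an \<open>\<epsilon>\<close>-\<open>\<delta>\<close> condition on
  single elements: on each ball, \<open>T\<close> almost commutes with every \<open>a\<close> that almost commutes with
  sufficiently many elements of \<open>S\<close>
  (\<open>approx_double_commutant_epsilon_delta\<close>). The condition passes from \<open>T\<close> to \<open>\<pi> T\<close> because \<open>\<pi>\<close> is
  bounded and because an \<open>e\<close> that almost commutes with \<open>\<pi> s\<close>, for finitely many \<open>s\<close>, is the image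
  of some \<open>a\<close> that almost commutes with these \<open>s\<close>, with control of the norm
  (\<open>almost_commuting_lift\<close>).

  For the lifting, take a preimage \<open>b\<close> of \<open>e\<close> of comparable norm (\<open>bounded_lift\<close>) and put
  \<open>a = b * v\<close>, where \<open>1 - v\<close> is a member far out in a quasicentral approximate unit of the kernel
  of \<open>\<pi>\<close>. Then \<open>\<pi> a = e\<close>, and \<open>s * a - a * s\<close> is the sum of \<open>(s * b - b * s) * v\<close> and
  \<open>b * (s * v - v * s)\<close>. The second term is small by quasicentrality. In the first,
  \<open>s * b - b * s\<close> differs from a bounded lift of \<open>\<pi> s * e - e * \<pi> s\<close> by an element of the kernel,
  and \<open>v\<close> almost annihilates that element.

  Quasicentrality (\<open>kernel_quasicentral_approx_unit\<close>) is obtained without convexity in the dual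
  space. Average \<open>n\<close> elements \<open>v\<close> chosen one after the other: the commutators with a fixed \<open>s\<close>
  are almost orthogonal, hence their sum has norm of order \<open>\<surd>n\<close>, and the commutator of the
  average has norm of order \<open>1 / \<surd>n\<close>.

  The analysis of single self-adjoint elements needs neither spectra nor the continuous functional
  calculus. If \<open>h\<close> and \<open>c\<close> are self-adjoint, commute and satisfy \<open>h\<^sup>2 + c\<^sup>2 = 1\<close>, then \<open>h + \<i> c\<close>
  is unitary and \<open>\<parallel>h\<parallel> \<le> 1\<close>. Square roots \<open>c\<close> of \<open>1 - h\<^sup>2\<close> for small \<open>h\<close>, and inverses of
  \<open>1 + b\<^sup>2\<close> for self-adjoint \<open>b\<close>, come from the contraction principle; they give the boundedness of
  \<open>\<pi>\<close>, the liftings \<open>2 b (1 + b\<^sup>2)\<^sup>-\<^sup>1\<close> of bounded norm, and the elements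
  \<open>v = (1 + t\<^sup>2 h\<^sup>2)\<^sup>-\<^sup>1\<close>.
\<close>

section \<open>Adjoints and norms\<close>

lemma norm_mult_le:
  fixes x y :: "'a::real_normed_algebra"
  assumes "norm x \<le> a" "norm y \<le> b"
  shows "norm (x * y) \<le> a * b"
  using norm_mult_ineq[of x y] mult_mono[OF assms] norm_ge_zero[of x] norm_ge_zero[of y] assms
  by linarith

lemma adj_zero [simp]: "adj (0::'a::unital_cstar_algebra) = 0"
  using adj_add[of "0::'a" 0] by simp

lemma adj_one [simp]: "adj (1::'a::unital_cstar_algebra) = 1"
  using adj_mult[of "adj (1::'a)" 1] by (simp add: adj_adj)

lemma adj_scaleR: "adj (r *\<^sub>R x) = r *\<^sub>R adj (x::'a::unital_cstar_algebra)"
  using adj_scaleC[of "complex_of_real r" x] by (simp add: scaleC_of_real)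

lemma adj_minus: "adj (- x) = - adj (x::'a::unital_cstar_algebra)"
  using adj_scaleR[of "-1" x] by simp

lemma adj_diff: "adj (x - y) = adj x - adj (y::'a::unital_cstar_algebra)"
  using adj_add[of x "- y"] by (simp add: adj_minus)

lemma norm_adj: "norm (adj x) = norm (x::'a::unital_cstar_algebra)"
proof -
  have le: "norm y \<le> norm (adj y)" for y :: 'a
  proof (cases "norm y = 0")
    case False
    have "norm y * norm y \<le> norm (adj y) * norm y"
      using norm_mult_ineq[of "adj y" y] by (simp add: cstar_identity power2_eq_square)
    with False show ?thesis
      by simp
  qed simp
  show ?thesis
    using le[of x] le[of "adj x"] by (simp add: adj_adj)
qed

lemma norm_one_le: "norm (1::'a::unital_cstar_algebra) \<le> 1"
proof -
  have "norm (1::'a) = norm (1::'a) ^ 2"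
    using cstar_identity[of "1::'a"] by simp
  then show ?thesis
    by (cases "norm (1::'a) = 0") (simp_all add: power2_eq_square)
qed

lemma bounded_linear_adj: "bounded_linear (adj :: 'a::unital_cstar_algebra \<Rightarrow> 'a)"
  by (rule bounded_linear_intro[of _ 1]) (simp_all add: adj_add adj_scaleR norm_adj)

lemma scaleC_diff_right: "scaleC c (x - y) = scaleC c x - scaleC c (y::'a::unital_cstar_algebra)"
  using scaleC_add_right[of c "x - y" y] by (simp add: algebra_simps)

lemma scaleC_minus_i: "scaleC (-\<i>) x = - scaleC \<i> (x::'a::unital_cstar_algebra)"
  using scaleC_add_left[of "-\<i>" \<i> x] scaleC_of_real[of 0 x] by (simp add: eq_neg_iff_add_eq_0)

lemma scaleC_i_i: "scaleC \<i> (scaleC \<i> x) = - (x::'a::unital_cstar_algebra)"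
  using scaleC_of_real[of "-1" x] by (simp add: scaleC_scaleC)

text \<open>
  The element \<open>h + \<i> c\<close> is unitary, and \<open>h\<close> is its real part.
\<close>

lemma norm_le_one_of_squares_sum_one:
  fixes h c :: "'a::unital_cstar_algebra"
  assumes "adj h = h" "adj c = c" "h * c = c * h" "h * h + c * c = 1"
  shows "norm h \<le> 1"
proof -
  define w where "w = h + scaleC \<i> c"
  have w': "adj w = h + scaleC (-\<i>) c"
    using assms by (simp add: w_def adj_add adj_scaleC)
  have "adj w * w = h * h + c * c"
    unfolding w' by (simp add: w_def scaleC_minus_i scaleC_i_i algebra_simps mult_scaleC_left
        mult_scaleC_right scaleC_add_right scaleC_diff_right assms(3))
  then have "norm w ^ 2 \<le> 1"
    using cstar_identity[of w] norm_one_le assms(4) by metis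
  then have "norm w \<le> 1"
    by (simp add: power_le_one_iff abs_square_le_1)
  moreover have "w + adj w = 2 *\<^sub>R h"
    by (simp add: w_def w'[unfolded w_def] scaleC_minus_i scaleR_2)
  then have "2 * norm h \<le> norm w + norm (adj w)"
    using norm_triangle_ineq[of w "adj w"] by simp
  ultimately show ?thesis
    by (simp add: norm_adj)
qed

section \<open>Square roots and inverses by contraction\<close>

text \<open>
  The self-adjoint elements of the double commutant of \<open>{a}\<close>. For self-adjoint \<open>a\<close> this is a
  closed commutative real subalgebra that contains \<open>1\<close> and \<open>a\<close>.
\<close>

definition selfadj_bicommutant :: "'a::unital_cstar_algebra \<Rightarrow> 'a set" where
  "selfadj_bicommutant a = {y. adj y = y \<and> (\<forall>z. z * a = a * z \<longrightarrow> z * y = y * z)}"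

lemma selfadj_bicommutantI:
  "adj y = y \<Longrightarrow> (\<And>z. z * a = a * z \<Longrightarrow> z * y = y * z) \<Longrightarrow> y \<in> selfadj_bicommutant a"
  unfolding selfadj_bicommutant_def by blast

lemma selfadj_bicommutant_adj: "y \<in> selfadj_bicommutant a \<Longrightarrow> adj y = y"
  unfolding selfadj_bicommutant_def by blast

lemma selfadj_bicommutantD: "y \<in> selfadj_bicommutant a \<Longrightarrow> z * a = a * z \<Longrightarrow> z * y = y * z"
  unfolding selfadj_bicommutant_def by blast

lemma selfadj_bicommutant_commute:
  assumes "x \<in> selfadj_bicommutant a" "y \<in> selfadj_bicommutant a"
  shows "x * y = y * x"
proof -
  have "y * a = a * y"
    by (rule selfadj_bicommutantD[OF assms(2) refl, symmetric])
  then show ?thesis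
    by (rule selfadj_bicommutantD[OF assms(1), symmetric])
qed

lemma selfadj_bicommutant_self: "adj a = a \<Longrightarrow> a \<in> selfadj_bicommutant a"
  by (rule selfadj_bicommutantI)

lemma selfadj_bicommutant_zero: "0 \<in> selfadj_bicommutant a"
  by (rule selfadj_bicommutantI) simp_all

lemma selfadj_bicommutant_one: "1 \<in> selfadj_bicommutant a"
  by (rule selfadj_bicommutantI) simp_all

lemma selfadj_bicommutant_add:
  assumes "x \<in> selfadj_bicommutant a" "y \<in> selfadj_bicommutant a"
  shows "x + y \<in> selfadj_bicommutant a"
  by (rule selfadj_bicommutantI)
    (simp_all only: adj_add distrib_left distrib_right assms[THEN selfadj_bicommutant_adj]
      assms[THEN selfadj_bicommutantD])

lemma selfadj_bicommutant_scaleR: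
  assumes "x \<in> selfadj_bicommutant a"
  shows "r *\<^sub>R x \<in> selfadj_bicommutant a"
  by (rule selfadj_bicommutantI)
    (simp_all only: adj_scaleR mult_scaleR_left mult_scaleR_right
      selfadj_bicommutant_adj[OF assms] selfadj_bicommutantD[OF assms])

lemma selfadj_bicommutant_diff:
  assumes "x \<in> selfadj_bicommutant a" "y \<in> selfadj_bicommutant a"
  shows "x - y \<in> selfadj_bicommutant a"
  using selfadj_bicommutant_add[OF assms(1) selfadj_bicommutant_scaleR[OF assms(2), of "-1"]]
  by simp

lemma selfadj_bicommutant_mult:
  assumes "x \<in> selfadj_bicommutant a" "y \<in> selfadj_bicommutant a"
  shows "x * y \<in> selfadj_bicommutant a"
proof (rule selfadj_bicommutantI)
  show "adj (x * y) = x * y"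
    using selfadj_bicommutant_commute[OF assms] by (simp only: adj_mult assms[THEN selfadj_bicommutant_adj])
  fix z assume "z * a = a * z"
  then have "z * x = x * z" "z * y = y * z"
    using assms by (blast dest: selfadj_bicommutantD)+
  then show "z * (x * y) = x * y * z"
    by (metis mult.assoc)
qed

lemmas selfadj_bicommutant_intros =
  selfadj_bicommutant_zero selfadj_bicommutant_one selfadj_bicommutant_add
  selfadj_bicommutant_diff selfadj_bicommutant_scaleR selfadj_bicommutant_mult

lemma closed_selfadj_bicommutant: "closed (selfadj_bicommutant (a::'a::unital_cstar_algebra))"
proof -
  have "closed {y::'a. adj y = y}"
    by (intro closed_Collect_eq linear_continuous_on bounded_linear_adj continuous_on_id)
  moreover have "closed {y. z * a = a * z \<longrightarrow> z * y = y * z}" for z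
    by (intro closed_Collect_imp closed_Collect_eq open_Collect_const continuous_intros)
  ultimately show ?thesis
    unfolding selfadj_bicommutant_def by (intro closed_Collect_conj closed_Collect_all)
qed

text \<open>
  With \<open>q = 1\<close> the solution \<open>y\<close> gives the square root \<open>1 - y\<close> of \<open>1 - p\<close>; with \<open>q = p\<close> it
  solves \<open>2 y = p (1 + y\<^sup>2)\<close>.
\<close>

lemma quadratic_fixed_point:
  fixes a :: "'a::unital_cstar_algebra"
  assumes p: "p \<in> selfadj_bicommutant a" "norm p \<le> 1/2"
    and q: "q \<in> selfadj_bicommutant a" "norm q \<le> 1"
  obtains y where "y \<in> selfadj_bicommutant a" "norm y \<le> 1/2" "2 *\<^sub>R y = p + q * (y * y)"
proof -
  define X where "X = selfadj_bicommutant a \<inter> cball 0 (1/2)"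
  define f where "f y = (1/2) *\<^sub>R (p + q * (y * y))" for y
  have X: "y \<in> X \<longleftrightarrow> y \<in> selfadj_bicommutant a \<and> norm y \<le> 1/2" for y
    by (simp add: X_def)
  have "\<exists>!y\<in>X. f y = y"
  proof (rule Banach_fix)
    show "complete X"
      unfolding X_def complete_eq_closed by (intro closed_Int closed_selfadj_bicommutant closed_cball)
    show "X \<noteq> {}"
      using X[of 0] selfadj_bicommutant_zero by auto
    show "f ` X \<subseteq> X"
    proof
      fix z assume "z \<in> f ` X"
      then obtain y where y: "y \<in> X" "z = f y"
        by blast
      have "norm (q * (y * y)) \<le> 1 * (1/2 * (1/2))"
        using y(1) q(2) unfolding X by (blast intro: norm_mult_le)
      then have "norm (f y) \<le> 1/2"
        using norm_triangle_ineq[of p "q * (y * y)"] p(2) by (simp add: f_def)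
      then show "z \<in> X"
        using y p(1) q(1) unfolding X f_def by (auto intro!: selfadj_bicommutant_intros)
    qed
    show "dist (f x) (f y) \<le> 1/2 * dist x y" if "x \<in> X" "y \<in> X" for x y
    proof -
      have "f x - f y = (1/2) *\<^sub>R (q * (x * (x - y) + (x - y) * y))"
        by (simp add: f_def algebra_simps)
      moreover have "norm (x * (x - y)) \<le> 1/2 * norm (x - y)" "norm ((x - y) * y) \<le> norm (x - y) * (1/2)"
        using that unfolding X by (blast intro: norm_mult_le)+
      then have "norm (x * (x - y) + (x - y) * y) \<le> norm (x - y)"
        using norm_triangle_ineq[of "x * (x - y)" "(x - y) * y"] by linarith
      then have "norm (q * (x * (x - y) + (x - y) * y)) \<le> 1 * norm (x - y)"
        using q(2) by (blast intro: norm_mult_le)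
      ultimately show ?thesis
        by (simp add: dist_norm)
    qed
  qed auto
  then obtain y where "y \<in> X" "f y = y"
    by blast
  moreover from this(2) have "2 *\<^sub>R y = 2 *\<^sub>R f y"
    by simp
  then have "2 *\<^sub>R y = p + q * (y * y)"
    by (simp add: f_def)
  ultimately show thesis
    using that X by blast
qed

lemma exists_sqrt_one_minus_square:
  fixes h :: "'a::unital_cstar_algebra"
  assumes "adj h = h" "norm h ^ 2 \<le> 1/2"
  obtains c where "c \<in> selfadj_bicommutant h" "h * h + c * c = 1"
proof -
  have "norm (h * h) \<le> 1/2"
    using norm_mult_ineq[of h h] assms by (simp add: power2_eq_square)
  moreover have "h * h \<in> selfadj_bicommutant h"
    using assms(1) by (intro selfadj_bicommutant_mult selfadj_bicommutant_self)
  ultimately obtain y where y: "y \<in> selfadj_bicommutant h" "2 *\<^sub>R y = h * h + 1 * (y * y)"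
    using quadratic_fixed_point[OF _ _ selfadj_bicommutant_one norm_one_le] by metis
  have "h * h + (1 - y) * (1 - y) = 1 + (h * h + 1 * (y * y)) - 2 *\<^sub>R y"
    by (simp add: algebra_simps scaleR_2)
  then have "h * h + (1 - y) * (1 - y) = 1"
    using y(2) by simp
  with y(1) show thesis
    by (intro that[of "1 - y"] selfadj_bicommutant_intros)
qed

lemma norm_le_one_of_bicommutant_squares_sum_one:
  fixes h c :: "'a::unital_cstar_algebra"
  assumes "h \<in> selfadj_bicommutant a" "c \<in> selfadj_bicommutant a" "h * h + c * c = 1"
  shows "norm h \<le> 1" "norm c \<le> 1"
proof -
  have "c * c + h * h = 1"
    using assms(3) by (simp only: add.commute)
  then show "norm h \<le> 1" "norm c \<le> 1"
    using norm_le_one_of_squares_sum_one selfadj_bicommutant_commute selfadj_bicommutant_adj assms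
    by metis+
qed

text \<open>
  The element \<open>r\<close> is the inverse of \<open>1 + b\<^sup>2\<close>. Its bounds come from \<open>((1 - b\<^sup>2) r)\<^sup>2 + (2 b r)\<^sup>2 = 1\<close>, that is, from the Cayley transform
  \<open>(1 + \<i> b)\<^sup>2 r\<close> being unitary.
\<close>

lemma exists_inverse_one_plus_square:
  fixes b :: "'a::unital_cstar_algebra"
  assumes b: "adj b = b"
  obtains r where "r + b * b * r = 1" "norm r \<le> 1" "norm (2 *\<^sub>R (b * r)) \<le> 1"
proof -
  note bb = selfadj_bicommutant_self[OF b]
  define M where "M = 1 + 2 * norm b ^ 2"
  have M: "M \<ge> 1" "M > 0"
    by (simp_all add: M_def add_pos_nonneg)
  define h where "h = (1 / sqrt M) *\<^sub>R b"
  have hh: "h * h = (1 / M) *\<^sub>R (b * b)"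
    using M by (simp add: h_def)
  have h: "h \<in> selfadj_bicommutant b" "adj h = h"
    using bb b by (auto simp: h_def adj_scaleR intro: selfadj_bicommutant_intros)
  have "norm h ^ 2 = norm b ^ 2 / M"
    using M by (simp add: h_def power_divide)
  also have "\<dots> \<le> 1/2"
    using M(2) by (simp add: pos_divide_le_eq) (simp add: M_def)
  finally obtain c where c: "c \<in> selfadj_bicommutant h" "h * h + c * c = 1"
    using exists_sqrt_one_minus_square h(2) by blast
  have cb: "c \<in> selfadj_bicommutant b"
    using c(1) by (auto simp: selfadj_bicommutant_def h_def)
  \<comment> \<open>\<open>1 + b\<^sup>2 = (1 + M) - M c\<^sup>2\<close> with \<open>\<parallel>c\<parallel> \<le> 1\<close>, so that the Neumann iteration converges.\<close>
  define q where "q = (M / (1 + M)) *\<^sub>R (c * c)"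
  have "norm (c * c) \<le> 1"
    using norm_mult_le[of c 1 c 1]
      norm_le_one_of_bicommutant_squares_sum_one(2)[OF h(1) cb c(2)] by simp
  then have nq: "norm q \<le> M / (1 + M)"
    using M by (simp add: q_def mult_left_le divide_right_mono)
  have qb: "q \<in> selfadj_bicommutant b"
    using cb by (auto simp: q_def intro!: selfadj_bicommutant_intros)
  define f where "f r = (1 / (1 + M)) *\<^sub>R 1 + q * r" for r
  have "\<exists>!r\<in>selfadj_bicommutant b. f r = r"
  proof (rule Banach_fix)
    show "complete (selfadj_bicommutant b)"
      unfolding complete_eq_closed by (rule closed_selfadj_bicommutant)
    show "f ` selfadj_bicommutant b \<subseteq> selfadj_bicommutant b"
      using qb by (auto simp: f_def intro!: selfadj_bicommutant_intros)
    show "dist (f x) (f y) \<le> M / (1 + M) * dist x y" for x y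
    proof -
      have "f x - f y = q * (x - y)"
        by (simp add: f_def algebra_simps)
      then show ?thesis
        unfolding dist_norm using norm_mult_le[OF nq order_refl] by metis
    qed
  qed (use M selfadj_bicommutant_zero in auto)
  then obtain r where r: "r \<in> selfadj_bicommutant b" "f r = r"
    by blast
  have Mcc: "M *\<^sub>R (c * c) = M *\<^sub>R 1 - b * b"
    using c(2) M by (simp add: hh algebra_simps flip: c(2))
  have "(1 + M) *\<^sub>R r = (1 + M) *\<^sub>R f r"
    using r by simp
  also have "\<dots> = 1 + (M *\<^sub>R (c * c)) * r"
    using M by (simp add: f_def q_def scaleR_add_right)
  also have "\<dots> = 1 + M *\<^sub>R r - b * b * r"
    by (simp add: Mcc algebra_simps)
  finally have inv: "r + b * b * r = 1"
    by (simp add: algebra_simps)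
  \<comment> \<open>\<open>x\<close> and \<open>y\<close> are the real and imaginary parts of \<open>(1 + \<i> b)\<^sup>2 r\<close>.\<close>
  define x where "x = r - b * b * r"
  define y where "y = 2 *\<^sub>R (b * r)"
  have xy: "x \<in> selfadj_bicommutant b" "y \<in> selfadj_bicommutant b"
    using r bb by (auto simp: x_def y_def intro!: selfadj_bicommutant_intros)
  have "b * r = r * b"
    using selfadj_bicommutant_commute[OF bb r(1)] .
  then have comm: "r * (b * z) = b * (r * z)" for z
    by (metis mult.assoc)
  have "x * x + y * y = (r + b * b * r) * (r + b * b * r)"
    by (simp add: x_def y_def algebra_simps comm scaleR_2[of "2 *\<^sub>R _"] scaleR_2 flip: scaleR_scaleR)
  then have "x * x + y * y = 1"
    by (simp add: inv)
  note n = norm_le_one_of_bicommutant_squares_sum_one[OF xy this]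
  have "2 *\<^sub>R r = 1 + x"
    using inv by (simp add: x_def scaleR_2 algebra_simps)
  then have "2 * norm r \<le> norm (1::'a) + norm x"
    using norm_triangle_ineq[of 1 x] by (metis norm_scaleR abs_numeral)
  then have "norm r \<le> 1"
    using n(1) norm_one_le[where 'a='a] by linarith
  then show thesis
    using that inv n(2) by (simp add: y_def)
qed

section \<open>Star homomorphisms: boundedness and bounded liftings\<close>

lemma unital_star_hom_simps:
  assumes "unital_star_hom \<pi>"
  shows "\<pi> (x + y) = \<pi> x + \<pi> y" "\<pi> (x - y) = \<pi> x - \<pi> y" "\<pi> (- x) = - \<pi> x" "\<pi> 0 = 0"
    "\<pi> (x * y) = \<pi> x * \<pi> y" "\<pi> (adj x) = adj (\<pi> x)" "\<pi> 1 = 1" "\<pi> (r *\<^sub>R x) = r *\<^sub>R \<pi> x"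
proof -
  have "\<pi> (scaleC (complex_of_real r) x) = scaleC (complex_of_real r) (\<pi> x)" for r x
    using assms by (simp add: unital_star_hom_def)
  then have s: "\<pi> (r *\<^sub>R x) = r *\<^sub>R \<pi> x" for r x
    by (simp add: scaleC_of_real)
  have add: "\<pi> (x + y) = \<pi> x + \<pi> y" for x y
    using assms by (simp add: unital_star_hom_def)
  show "\<pi> (x + y) = \<pi> x + \<pi> y" "\<pi> (x * y) = \<pi> x * \<pi> y" "\<pi> (adj x) = adj (\<pi> x)" "\<pi> 1 = 1"
    using assms by (simp_all add: unital_star_hom_def)
  show "\<pi> (r *\<^sub>R x) = r *\<^sub>R \<pi> x" "\<pi> (- x) = - \<pi> x" "\<pi> 0 = 0"
    using s[of r x] s[of "-1" x] s[of 0 0] by simp_all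
  show "\<pi> (x - y) = \<pi> x - \<pi> y"
    using add[of x "-y"] s[of "-1" y] by simp
qed

lemma unital_star_hom_bounded:
  fixes \<pi> :: "'b::unital_cstar_algebra \<Rightarrow> 'e::unital_cstar_algebra"
  assumes \<pi>: "unital_star_hom \<pi>"
  shows "norm (\<pi> x) \<le> 2 * norm x"
proof -
  note [simp] = unital_star_hom_simps[OF \<pi>]
  \<comment> \<open>Applying \<open>\<pi>\<close> to \<open>h\<^sup>2 + c\<^sup>2 = 1\<close> bounds \<open>\<pi> h\<close> algebraically.\<close>
  have small: "norm (\<pi> h) \<le> 1" if h: "adj h = h" "norm h ^ 2 \<le> 1/2" for h
  proof -
    obtain c where c: "c \<in> selfadj_bicommutant h" "h * h + c * c = 1"
      using exists_sqrt_one_minus_square[OF h] .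
    show ?thesis
    proof (rule norm_le_one_of_squares_sum_one)
      show "adj (\<pi> h) = \<pi> h" "adj (\<pi> c) = \<pi> c"
        using h(1) selfadj_bicommutant_adj[OF c(1)] unital_star_hom_simps(6)[OF \<pi>] by metis+
      show "\<pi> h * \<pi> c = \<pi> c * \<pi> h"
        using selfadj_bicommutant_commute[OF selfadj_bicommutant_self[OF h(1)] c(1)]
          unital_star_hom_simps(5)[OF \<pi>] by metis
      show "\<pi> h * \<pi> h + \<pi> c * \<pi> c = 1"
        using arg_cong[OF c(2), of \<pi>] by simp
    qed
  qed
  show ?thesis
  proof (cases "x = 0")
    case False
    define N where "N = 2 * norm x ^ 2"
    have N: "N > 0"
      using False by (simp add: N_def)
    define h where "h = (1 / N) *\<^sub>R (adj x * x)"
    have "norm h = 1/2"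
      using N by (simp add: h_def cstar_identity) (simp add: N_def)
    moreover have "adj h = h"
      by (simp add: h_def adj_scaleR adj_mult adj_adj)
    ultimately have "norm (\<pi> h) \<le> 1"
      by (intro small) (simp_all only: power_divide, simp)
    then have "norm (\<pi> x) ^ 2 \<le> N"
      using N by (simp add: h_def cstar_identity)
    also have "\<dots> \<le> (2 * norm x) ^ 2"
      by (simp add: N_def power_mult_distrib)
    finally show ?thesis
      by (rule power2_le_imp_le) simp
  qed simp
qed

text \<open>
  A self-adjoint \<open>e\<close> of norm at most \<open>1/2\<close> has the form \<open>2 g (1 + g\<^sup>2)\<^sup>-\<^sup>1\<close>; the same expression in any
  self-adjoint preimage of \<open>g\<close> is a preimage of \<open>e\<close> of norm at most \<open>1\<close>.
\<close>

lemma bounded_lift_selfadj_small: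
  fixes \<pi> :: "'b::unital_cstar_algebra \<Rightarrow> 'e::unital_cstar_algebra"
  assumes \<pi>: "unital_star_hom \<pi>" and surj: "surj \<pi>" and e: "adj e = e" "norm e \<le> 1/2"
  obtains x where "\<pi> x = e" "norm x \<le> 1"
proof -
  note [simp] = unital_star_hom_simps[OF \<pi>]
  note ee = selfadj_bicommutant_self[OF e(1)]
  obtain g where g: "g \<in> selfadj_bicommutant e" "2 *\<^sub>R g = e + e * (g * g)"
    using quadratic_fixed_point[OF ee e(2) ee] e(2) by force
  obtain b0 where b0: "\<pi> b0 = g"
    using surj by (metis surjD)
  define b where "b = (1/2) *\<^sub>R (b0 + adj b0)"
  have b: "adj b = b" "\<pi> b = g"
    using b0 selfadj_bicommutant_adj[OF g(1)]
    by (simp_all add: b_def adj_scaleR adj_add adj_adj add.commute flip: scaleR_2)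
  obtain r where r: "r + b * b * r = 1" "norm (2 *\<^sub>R (b * r)) \<le> 1"
    using exists_inverse_one_plus_square[OF b(1)] .
  have r': "\<pi> r + g * g * \<pi> r = 1"
    using arg_cong[OF r(1), of \<pi>] b(2) by simp
  have "\<pi> (2 *\<^sub>R (b * r)) = (2 *\<^sub>R g) * \<pi> r"
    using b(2) by simp
  also have "\<dots> = e * (\<pi> r + g * g * \<pi> r)"
    by (simp add: g(2) algebra_simps)
  finally show thesis
    using that[of "2 *\<^sub>R (b * r)"] r' r(2) by simp
qed

lemma bounded_lift_selfadj:
  fixes \<pi> :: "'b::unital_cstar_algebra \<Rightarrow> 'e::unital_cstar_algebra"
  assumes \<pi>: "unital_star_hom \<pi>" and surj: "surj \<pi>" and e: "adj e = e"
  obtains x where "\<pi> x = e" "norm x \<le> 2 * norm e"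
proof (cases "e = 0")
  case True
  then show thesis
    using that[of 0] unital_star_hom_simps[OF \<pi>] by simp
next
  case False
  define t where "t = 2 * norm e"
  have t: "t > 0"
    using False by (simp add: t_def)
  have "adj ((1/t) *\<^sub>R e) = (1/t) *\<^sub>R e" "norm ((1/t) *\<^sub>R e) \<le> 1/2"
    using t by (simp_all add: adj_scaleR e) (simp add: t_def)
  then obtain x where x: "\<pi> x = (1/t) *\<^sub>R e" "norm x \<le> 1"
    using bounded_lift_selfadj_small[OF \<pi> surj] by metis
  show thesis
    using that[of "t *\<^sub>R x"] x t unital_star_hom_simps(8)[OF \<pi>]
    by (simp add: t_def mult_left_le)
qed

lemma bounded_lift:
  fixes \<pi> :: "'b::unital_cstar_algebra \<Rightarrow> 'e::unital_cstar_algebra"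
  assumes \<pi>: "unital_star_hom \<pi>" and surj: "surj \<pi>"
  obtains x where "\<pi> x = e" "norm x \<le> 4 * norm e"
proof -
  \<comment> \<open>The real part \<open>p\<close> and the imaginary part \<open>q\<close> of \<open>e\<close> are lifted separately.\<close>
  define p where "p = (1/2) *\<^sub>R (e + adj e)"
  define q where "q = (1/2) *\<^sub>R scaleC \<i> (adj e - e)"
  have "adj p = p" "adj q = q"
    by (simp_all add: p_def q_def adj_scaleR adj_add adj_diff adj_scaleC adj_adj add.commute
        scaleC_minus_i scaleC_diff_right)
  then obtain x y where xy: "\<pi> x = p" "norm x \<le> 2 * norm p" "\<pi> y = q" "norm y \<le> 2 * norm q"
    using bounded_lift_selfadj[OF \<pi> surj] by metis
  have "norm p \<le> norm e" "norm q \<le> norm e"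
    using norm_triangle_ineq[of e "adj e"] norm_triangle_ineq4[of "adj e" e]
    by (simp_all add: p_def q_def norm_scaleC norm_adj)
  moreover have "scaleC \<i> q = (1/2) *\<^sub>R (e - adj e)"
  proof -
    have "scaleC \<i> q = scaleC (complex_of_real (1/2)) (scaleC \<i> (scaleC \<i> (adj e - e)))"
      unfolding q_def scaleC_of_real[symmetric] scaleC_scaleC by (simp add: mult.commute)
    then show ?thesis
      unfolding scaleC_i_i scaleC_of_real by simp
  qed
  then have "p + scaleC \<i> q = e"
    by (simp add: p_def flip: scaleR_add_right scaleR_2)
  then have "\<pi> (x + scaleC \<i> y) = e"
    using xy \<pi> by (simp add: unital_star_hom_def)
  moreover have "norm (x + scaleC \<i> y) \<le> norm x + norm y"
    using norm_triangle_ineq[of x "scaleC \<i> y"] by (simp add: norm_scaleC)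
  ultimately show thesis
    using that[of "x + scaleC \<i> y"] xy by simp
qed

section \<open>A quasicentral approximate unit of the kernel\<close>

text \<open>
  An approximate unit \<open>u\<close> of the kernel of \<open>\<pi>\<close> enters through \<open>v = 1 - u\<close>, that is, through
  elements with \<open>\<pi> v = 1\<close>.
\<close>

lemma kernel_right_approx_unit_single:
  fixes \<pi> :: "'b::unital_cstar_algebra \<Rightarrow> 'e::unital_cstar_algebra"
  assumes \<pi>: "unital_star_hom \<pi>" and x: "\<pi> x = 0" and \<epsilon>: "\<epsilon> > 0"
  obtains v where "\<pi> v = 1" "norm v \<le> 1" "norm (x * v) < \<epsilon>"
proof -
  note [simp] = unital_star_hom_simps[OF \<pi>]
  define h where "h = adj x * x"
  \<comment> \<open>Since \<open>\<parallel>2 t h v\<parallel> \<le> 1\<close> for \<open>v = (1 + t\<^sup>2 h\<^sup>2)\<^sup>-\<^sup>1\<close>, this \<open>t\<close> makes \<open>\<parallel>x v\<parallel>\<^sup>2 \<le> \<parallel>h v\<parallel> \<le> \<epsilon>\<^sup>2 / 2\<close>.\<close>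
  define t where "t = 1 / \<epsilon> ^ 2"
  have t: "t > 0"
    using \<epsilon> by (simp add: t_def)
  have th: "adj (t *\<^sub>R h) = t *\<^sub>R h"
    by (simp add: h_def adj_scaleR adj_mult adj_adj)
  obtain v where v: "v + (t *\<^sub>R h) * (t *\<^sub>R h) * v = 1" "norm v \<le> 1"
      "norm (2 *\<^sub>R ((t *\<^sub>R h) * v)) \<le> 1"
    using exists_inverse_one_plus_square[OF th] .
  have "\<pi> v = 1"
    using arg_cong[OF v(1), of \<pi>] x by (simp add: h_def)
  have "norm (h * v) \<le> \<epsilon> ^ 2 / 2"
    using v(3) \<epsilon> by (simp add: t_def field_simps)
  have "norm (x * v) ^ 2 = norm (adj v * (h * v))"
    by (simp add: h_def adj_mult mult.assoc flip: cstar_identity)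
  also have "\<dots> \<le> 1 * (\<epsilon> ^ 2 / 2)"
    using v(2) \<open>norm (h * v) \<le> \<epsilon> ^ 2 / 2\<close> by (intro norm_mult_le) (simp_all add: norm_adj)
  also have "\<dots> < \<epsilon> ^ 2"
    using \<epsilon> by simp
  finally have "norm (x * v) < \<epsilon>"
    using \<epsilon> by (simp add: power2_less_imp_less)
  with \<open>\<pi> v = 1\<close> v(2) show thesis
    using that by blast
qed

text \<open>
  For several elements multiply the \<open>v\<close>'s: an element already made small by the earlier factors
  stays small, because the new factor stands on the right and has norm at most \<open>1\<close>.
\<close>

lemma kernel_right_approx_unit:
  fixes \<pi> :: "'b::unital_cstar_algebra \<Rightarrow> 'e::unital_cstar_algebra"
  assumes \<pi>: "unital_star_hom \<pi>" and G: "finite G" "\<And>x. x \<in> G \<Longrightarrow> \<pi> x = 0" and \<epsilon>: "\<epsilon> > 0"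
  shows "\<exists>v. \<pi> v = 1 \<and> norm v \<le> 1 \<and> (\<forall>x\<in>G. norm (x * v) < \<epsilon>)"
  using G
proof (induction G)
  case empty
  then show ?case
    using norm_one_le unital_star_hom_simps(7)[OF \<pi>] by auto
next
  case (insert y G)
  then obtain v where v: "\<pi> v = 1" "norm v \<le> 1" "\<forall>x\<in>G. norm (x * v) < \<epsilon>"
    by auto
  have "\<pi> (y * v) = 0"
    using insert.prems by (simp add: unital_star_hom_simps[OF \<pi>])
  then obtain w where w: "\<pi> w = 1" "norm w \<le> 1" "norm (y * v * w) < \<epsilon>"
    using kernel_right_approx_unit_single[OF \<pi> _ \<epsilon>] by blast
  have le: "norm (z * w) \<le> norm z" for z
    using norm_mult_le[OF order_refl w(2)] by simp
  show ?case
  proof (intro exI[of _ "v * w"] conjI ballI)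
    show "\<pi> (v * w) = 1"
      using v w by (simp add: unital_star_hom_simps[OF \<pi>])
    show "norm (v * w) \<le> 1"
      using le v(2) order_trans by blast
    show "norm (x * (v * w)) < \<epsilon>" if "x \<in> insert y G" for x
      using that v(3) w(3) le[of "x * v"] by (fastforce simp: mult.assoc)
  qed
qed

text \<open>
  The sum \<open>w\<close> of \<open>n\<close> elements \<open>v\<close> with \<open>\<pi> v = 1\<close>, each chosen after the previous ones, has
  commutators of norm \<open>O(\<surd>n)\<close> only: the commutator \<open>D\<close> with the partial sum lies in the kernel, so a new
  summand \<open>v\<close> can be chosen such that \<open>adj D * (s * v - v * s)\<close> is small. The two commutators are
  then almost orthogonal, and their squared norms almost add.
\<close>

lemma kernel_approx_unit_sum:
  fixes \<pi> :: "'b::unital_cstar_algebra \<Rightarrow> 'e::unital_cstar_algebra"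
  assumes \<pi>: "unital_star_hom \<pi>" and G: "finite G" "\<And>x. x \<in> G \<Longrightarrow> \<pi> x = 0" and \<epsilon>: "\<epsilon> > 0"
    and F: "finite F" "\<And>s. s \<in> F \<Longrightarrow> norm s \<le> B"
  shows "\<exists>w. \<pi> w = real n *\<^sub>R 1 \<and> norm w \<le> real n \<and> (\<forall>x\<in>G. norm (x * w) \<le> real n * \<epsilon>)
    \<and> (\<forall>s\<in>F. norm (s * w - w * s) ^ 2 \<le> real n * (4 * B ^ 2 + 1))"
proof (induction n)
  case 0
  then show ?case
    by (intro exI[of _ 0]) (simp add: unital_star_hom_simps[OF \<pi>])
next
  case (Suc n)
  note [simp] = unital_star_hom_simps[OF \<pi>]
  from Suc obtain w where w: "\<pi> w = real n *\<^sub>R 1" "norm w \<le> real n"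
    "\<And>x. x \<in> G \<Longrightarrow> norm (x * w) \<le> real n * \<epsilon>"
    "\<And>s. s \<in> F \<Longrightarrow> norm (s * w - w * s) ^ 2 \<le> real n * (4 * B ^ 2 + 1)"
    by blast
  define D where "D s = s * w - w * s" for s
  have D0: "\<pi> (D s) = 0" for s
    by (simp add: D_def w(1))
  define \<delta> where "\<delta> = min \<epsilon> (1 / (4 * (1 + \<bar>B\<bar>)))"
  have \<delta>: "\<delta> > 0" "\<delta> \<le> \<epsilon>" "\<delta> * (1 + \<bar>B\<bar>) \<le> 1/4"
    using \<epsilon> by (auto simp: \<delta>_def min_def field_simps)
  define H where "H = G \<union> (\<lambda>s. adj (D s)) ` F \<union> (\<lambda>s. adj (D s) * s) ` F"
  have "finite H" "\<And>x. x \<in> H \<Longrightarrow> \<pi> x = 0"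
    using G F(1) D0 by (auto simp: H_def)
  then obtain v where v: "\<pi> v = 1" "norm v \<le> 1" "\<And>x. x \<in> H \<Longrightarrow> norm (x * v) < \<delta>"
    using kernel_right_approx_unit[OF \<pi> _ _ \<delta>(1)] by metis
  show ?case
  proof (intro exI[of _ "w + v"] conjI ballI)
    show "\<pi> (w + v) = real (Suc n) *\<^sub>R 1"
      using v w by (simp add: scaleR_add_left)
    show "norm (w + v) \<le> real (Suc n)"
      using norm_triangle_ineq[of w v] v(2) w(2) by simp
  next
    fix x assume x: "x \<in> G"
    then have "norm (x * v) < \<delta>"
      by (intro v(3)) (simp add: H_def)
    then show "norm (x * (w + v)) \<le> real (Suc n) * \<epsilon>"
      using norm_triangle_ineq[of "x * w" "x * v"] w(3)[OF x] \<delta>(2) by (simp add: algebra_simps)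
  next
    fix s assume s: "s \<in> F"
    define d where "d = s * v - v * s"
    have "norm (s * v) \<le> B * 1" "norm (v * s) \<le> 1 * B"
      using F(2)[OF s] v(2) by (blast intro: norm_mult_le)+
    then have "norm d \<le> 2 * B"
      unfolding d_def using norm_triangle_ineq4[of "s * v" "v * s"] by linarith
    then have d2: "norm d ^ 2 \<le> 4 * B ^ 2"
      using power_mono[of "norm d" "2 * B" 2] by (simp add: power_mult_distrib)
    have "norm (adj (D s) * v * s) \<le> \<delta> * \<bar>B\<bar>"
      using v(3)[of "adj (D s)"] s F(2)[OF s]
      by (intro norm_mult_le) (auto simp: H_def less_imp_le)
    moreover have "norm (adj (D s) * s * v) < \<delta>"
      using s by (intro v(3)) (simp add: H_def)
    moreover have "adj (D s) * d = adj (D s) * s * v - adj (D s) * v * s"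
      by (simp add: d_def algebra_simps)
    ultimately have cross: "norm (adj (D s) * d) \<le> 1/4"
      using norm_triangle_ineq4[of "adj (D s) * s * v" "adj (D s) * v * s"] \<delta>(3)
      by (simp add: distrib_left)
    have "norm (adj d * D s) = norm (adj (D s) * d)"
      by (metis norm_adj adj_mult adj_adj)
    have "norm (D s + d) ^ 2 = norm ((adj (D s) * D s + adj d * d) + (adj (D s) * d + adj d * D s))"
      by (simp add: adj_add algebra_simps flip: cstar_identity)
    also have "\<dots> \<le> (norm (D s) ^ 2 + norm d ^ 2) + (norm (adj (D s) * d) + norm (adj d * D s))"
      unfolding cstar_identity[symmetric]
      by (intro norm_triangle_ineq[THEN order_trans] add_mono norm_triangle_ineq)
    also have "\<dots> \<le> (real n * (4 * B ^ 2 + 1) + 4 * B ^ 2) + 1"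
      using w(4)[OF s] d2 cross \<open>norm (adj d * D s) = norm (adj (D s) * d)\<close>
      unfolding D_def by linarith
    also have "\<dots> = real (Suc n) * (4 * B ^ 2 + 1)"
      by (simp add: algebra_simps)
    finally show "norm (s * (w + v) - (w + v) * s) ^ 2 \<le> real (Suc n) * (4 * B ^ 2 + 1)"
      by (simp add: D_def d_def algebra_simps)
  qed
qed

lemma kernel_quasicentral_approx_unit:
  fixes \<pi> :: "'b::unital_cstar_algebra \<Rightarrow> 'e::unital_cstar_algebra"
  assumes \<pi>: "unital_star_hom \<pi>" and G: "finite G" "\<And>x. x \<in> G \<Longrightarrow> \<pi> x = 0" and \<epsilon>: "\<epsilon> > 0"
    and F: "finite F"
  obtains v where "\<pi> v = 1" "norm v \<le> 1" "\<And>x. x \<in> G \<Longrightarrow> norm (x * v) \<le> \<epsilon>"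
    "\<And>s. s \<in> F \<Longrightarrow> norm (s * v - v * s) \<le> \<epsilon>"
proof -
  obtain B where B: "\<And>s. s \<in> F \<Longrightarrow> norm s \<le> B"
    using finite_imp_bounded[OF F] by (auto simp: bounded_iff)
  obtain n :: nat where n: "(4 * B ^ 2 + 1) / \<epsilon> ^ 2 < real n"
    using reals_Archimedean2 by blast
  then have "real n * \<epsilon> ^ 2 \<ge> 4 * B ^ 2 + 1"
    using \<epsilon> by (simp add: divide_less_eq)
  have "0 \<le> (4 * B ^ 2 + 1) / \<epsilon> ^ 2"
    by simp
  then have n0: "real n > 0"
    using n by linarith
  obtain w where w: "\<pi> w = real n *\<^sub>R 1" "norm w \<le> real n"
    "\<And>x. x \<in> G \<Longrightarrow> norm (x * w) \<le> real n * \<epsilon>"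
    "\<And>s. s \<in> F \<Longrightarrow> norm (s * w - w * s) ^ 2 \<le> real n * (4 * B ^ 2 + 1)"
    using kernel_approx_unit_sum[OF \<pi> G \<epsilon> F B, of n] by blast
  define v where "v = (1 / real n) *\<^sub>R w"
  show thesis
  proof (rule that[of v])
    show "\<pi> v = 1" "norm v \<le> 1"
      using n0 w(1,2) by (simp_all add: v_def unital_star_hom_simps[OF \<pi>])
    show "norm (x * v) \<le> \<epsilon>" if "x \<in> G" for x
      using w(3)[OF that] n0 by (simp add: v_def field_simps)
    show "norm (s * v - v * s) \<le> \<epsilon>" if "s \<in> F" for s
    proof -
      have "norm (s * w - w * s) ^ 2 \<le> real n * (real n * \<epsilon> ^ 2)"
        using w(4)[OF that] \<open>real n * \<epsilon> ^ 2 \<ge> 4 * B ^ 2 + 1\<close> n0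
        by (meson mult_left_mono less_imp_le order_trans)
      then have "norm (s * w - w * s) ^ 2 \<le> (real n * \<epsilon>) ^ 2"
        by (simp add: power2_eq_square algebra_simps)
      then have "norm (s * w - w * s) \<le> real n * \<epsilon>"
        by (rule power2_le_imp_le) (use \<epsilon> in simp)
      moreover have "s * v - v * s = (1 / real n) *\<^sub>R (s * w - w * s)"
        by (simp add: v_def scaleR_diff_right)
      ultimately show ?thesis
        using n0 by (simp add: pos_divide_le_eq mult.commute)
    qed
  qed
qed

lemma almost_commuting_lift:
  fixes \<pi> :: "'b::unital_cstar_algebra \<Rightarrow> 'e::unital_cstar_algebra"
  assumes \<pi>: "unital_star_hom \<pi>" and surj: "surj \<pi>" and F: "finite F" and \<epsilon>: "\<epsilon> > 0"
  obtains a where "\<pi> a = e" "norm a \<le> 4 * norm e"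
    "\<And>s. s \<in> F \<Longrightarrow> norm (s * a - a * s) \<le> 4 * norm (\<pi> s * e - e * \<pi> s) + \<epsilon>"
proof -
  note [simp] = unital_star_hom_simps[OF \<pi>]
  obtain b where b: "\<pi> b = e" "norm b \<le> 4 * norm e"
    using bounded_lift[OF \<pi> surj] .
  have "\<exists>y. \<pi> y = \<pi> s * e - e * \<pi> s \<and> norm y \<le> 4 * norm (\<pi> s * e - e * \<pi> s)" for s
    using bounded_lift[OF \<pi> surj] by metis
  then obtain y where y: "\<And>s. \<pi> (y s) = \<pi> s * e - e * \<pi> s"
    "\<And>s. norm (y s) \<le> 4 * norm (\<pi> s * e - e * \<pi> s)"
    by metis
  define k where "k s = s * b - b * s - y s" for s
  define \<delta> where "\<delta> = \<epsilon> / (1 + norm b)"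
  have pos: "1 + norm b > 0"
    using norm_ge_zero[of b] by linarith
  then have \<delta>: "\<delta> > 0" "\<delta> * (1 + norm b) = \<epsilon>"
    using \<epsilon> by (simp_all add: \<delta>_def)
  have "finite (k ` F)" "\<And>x. x \<in> k ` F \<Longrightarrow> \<pi> x = 0"
    using F by (auto simp: k_def b(1) y(1))
  then obtain v where v: "\<pi> v = 1" "norm v \<le> 1" "\<And>x. x \<in> k ` F \<Longrightarrow> norm (x * v) \<le> \<delta>"
    "\<And>s. s \<in> F \<Longrightarrow> norm (s * v - v * s) \<le> \<delta>"
    using kernel_quasicentral_approx_unit[OF \<pi> _ _ \<delta>(1) F] by metis
  have le: "norm (z * v) \<le> norm z" for z
    using norm_mult_le[OF order_refl v(2)] by simp
  show thesis
  proof (rule that[of "b * v"])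
    show "\<pi> (b * v) = e" "norm (b * v) \<le> 4 * norm e"
      using b v(1) le[of b] by simp_all
    fix s assume s: "s \<in> F"
    have "s * (b * v) - b * v * s = y s * v + k s * v + b * (s * v - v * s)"
      by (simp add: k_def algebra_simps)
    moreover have "norm (b * (s * v - v * s)) \<le> norm b * \<delta>"
      using v(4)[OF s] by (blast intro: norm_mult_le)
    moreover have "norm (k s * v) \<le> \<delta>"
      using v(3) s by blast
    ultimately show "norm (s * (b * v) - b * v * s) \<le> 4 * norm (\<pi> s * e - e * \<pi> s) + \<epsilon>"
      using norm_triangle_ineq[of "y s * v + k s * v" "b * (s * v - v * s)"]
        norm_triangle_ineq[of "y s * v" "k s * v"] le[of "y s"] y(2)[of s] \<delta>(2)
      by (simp add: algebra_simps)
  qed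
qed

section \<open>The approximate double commutant without nets\<close>

lemma approx_double_commutant_epsilon_delta:
  fixes S :: "'a::unital_cstar_algebra set"
  shows "T \<in> approx_double_commutant S \<longleftrightarrow>
    (\<forall>R. \<forall>\<epsilon>>0. \<exists>F \<delta>. finite F \<and> F \<subseteq> S \<and> \<delta> > 0 \<and>
      (\<forall>a. norm a \<le> R \<longrightarrow> (\<forall>s\<in>F. norm (s * a - a * s) < \<delta>) \<longrightarrow> norm (T * a - a * T) < \<epsilon>))"
    (is "_ \<longleftrightarrow> ?P")
proof
  assume T: "T \<in> approx_double_commutant S"
  \<comment> \<open>A counterexample for each pair of a finite set \<open>F\<close> and \<open>\<delta> = 1 / (n + 1)\<close> makes up a net.\<close>
  show ?P
  proof (rule ccontr)
    assume "\<not> ?P"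
    then obtain R \<epsilon> where \<epsilon>: "\<epsilon> > 0" and
      no: "\<And>F \<delta>. finite F \<Longrightarrow> F \<subseteq> S \<Longrightarrow> \<delta> > 0 \<Longrightarrow>
        \<exists>a. norm a \<le> R \<and> (\<forall>s\<in>F. norm (s * a - a * s) < \<delta>) \<and> \<epsilon> \<le> norm (T * a - a * T)"
      unfolding not_all not_imp not_ex de_Morgan_conj by (metis not_less)
    define I where "I = {F. finite F \<and> F \<subseteq> S} \<times> (UNIV :: nat set)"
    define le :: "'a set \<times> nat \<Rightarrow> 'a set \<times> nat \<Rightarrow> bool"
      where "le p q \<longleftrightarrow> fst p \<subseteq> fst q \<and> snd p \<le> snd q" for p q
    have dir: "directed_set I le"
      unfolding directed_set_def
    proof (intro conjI ballI impI)
      show "I \<noteq> {}"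
        by (auto simp: I_def)
      fix p q assume "p \<in> I" "q \<in> I"
      then show "\<exists>r\<in>I. le p r \<and> le q r"
        by (intro bexI[of _ "(fst p \<union> fst q, max (snd p) (snd q))"]) (auto simp: I_def le_def)
    qed (auto simp: le_def)
    have "\<forall>p\<in>I. \<exists>a. norm a \<le> R \<and> (\<forall>s\<in>fst p. norm (s * a - a * s) < 1 / real (Suc (snd p)))
        \<and> \<epsilon> \<le> norm (T * a - a * T)"
      using no by (auto simp: I_def)
    then obtain A where A: "\<And>p. p \<in> I \<Longrightarrow> norm (A p) \<le> R"
      "\<And>p s. p \<in> I \<Longrightarrow> s \<in> fst p \<Longrightarrow> norm (s * A p - A p * s) < 1 / real (Suc (snd p))"
      "\<And>p. p \<in> I \<Longrightarrow> \<epsilon> \<le> norm (T * A p - A p * T)"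
      by metis
    have "((\<lambda>p. norm (T * A p - A p * T)) \<longlongrightarrow> 0) (tails I le)"
    proof (rule approx_double_commutant_net[OF T dir])
      show "bounded (A ` I)"
        unfolding bounded_iff using A(1) by blast
      fix s assume s: "s \<in> S"
      show "((\<lambda>p. norm (s * A p - A p * s)) \<longlongrightarrow> 0) (tails I le)"
        unfolding tendsto_zero_tails[OF dir]
      proof (intro allI impI)
        fix e :: real assume "e > 0"
        then obtain n where n: "1 / real (Suc n) < e"
          using nat_approx_posE by blast
        have "\<bar>norm (s * A q - A q * s)\<bar> < e" if q: "q \<in> I" "le ({s}, n) q" for q
        proof -
          have "norm (s * A q - A q * s) < 1 / real (Suc (snd q))"
            using q by (intro A(2)) (auto simp: le_def)
          also have "\<dots> \<le> 1 / real (Suc n)"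
            using q(2) by (intro divide_left_mono) (auto simp: le_def)
          finally show ?thesis
            using n by simp
        qed
        then show "\<exists>p\<in>I. \<forall>q\<in>I. le p q \<longrightarrow> \<bar>norm (s * A q - A q * s)\<bar> < e"
          using s by (intro bexI[of _ "({s}, n)"]) (auto simp: I_def)
      qed
    qed
    then obtain p where "p \<in> I" "\<And>q. q \<in> I \<Longrightarrow> le p q \<Longrightarrow> norm (T * A q - A q * T) < \<epsilon>"
      using \<epsilon> unfolding tendsto_zero_tails[OF dir] by auto
    then show False
      using A(3)[of p] by (force simp: le_def)
  qed
next
  assume P: ?P
  show "T \<in> approx_double_commutant S"
    unfolding approx_double_commutant_def mem_Collect_eq
  proof (intro allI impI)
    fix I :: "('a set \<times> 'a) set" and le A
    assume dir: "directed_set I le" and bdd: "bounded (A ` I)"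
      and lim: "\<forall>s\<in>S. ((\<lambda>i. norm (s * A i - A i * s)) \<longlongrightarrow> 0) (tails I le)"
    obtain R where R: "\<And>i. i \<in> I \<Longrightarrow> norm (A i) \<le> R"
      using bdd by (auto simp: bounded_iff)
    have in_I: "eventually (\<lambda>i. i \<in> I) (tails I le)"
      using dir unfolding eventually_tails[OF dir] directed_set_def by blast
    show "((\<lambda>i. norm (T * A i - A i * T)) \<longlongrightarrow> 0) (tails I le)"
    proof (rule tendstoI)
      fix \<epsilon> :: real assume "\<epsilon> > 0"
      then obtain F \<delta> where F: "finite F" "F \<subseteq> S" "\<delta> > 0" and
        small: "\<And>a. norm a \<le> R \<Longrightarrow> \<forall>s\<in>F. norm (s * a - a * s) < \<delta> \<Longrightarrow> norm (T * a - a * T) < \<epsilon>"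
        using P by metis
      have "eventually (\<lambda>i. \<forall>s\<in>F. norm (s * A i - A i * s) < \<delta>) (tails I le)"
      proof (intro eventually_ball_finite[OF F(1)] ballI)
        fix s assume "s \<in> F"
        then have "((\<lambda>i. norm (s * A i - A i * s)) \<longlongrightarrow> 0) (tails I le)"
          using F(2) lim by blast
        then show "eventually (\<lambda>i. norm (s * A i - A i * s) < \<delta>) (tails I le)"
          using F(3) by (rule order_tendstoD(2))
      qed
      then show "eventually (\<lambda>i. dist (norm (T * A i - A i * T)) 0 < \<epsilon>) (tails I le)"
        using in_I by eventually_elim (use small R in simp)
    qed
  qed
qed

section \<open>Images of approximate double commutants\<close>

theorem theorem17:
  fixes \<pi> :: "'b::unital_cstar_algebra \<Rightarrow> 'e::unital_cstar_algebra"
    and S :: "'b set"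
  assumes "unital_star_hom \<pi>"
    and "surj \<pi>"
  shows "\<pi> ` approx_double_commutant S \<subseteq> approx_double_commutant (\<pi> ` S)"
proof
  note [simp] = unital_star_hom_simps[OF assms(1)]
  fix T' assume "T' \<in> \<pi> ` approx_double_commutant S"
  then obtain T where T: "T \<in> approx_double_commutant S" "T' = \<pi> T"
    by blast
  show "T' \<in> approx_double_commutant (\<pi> ` S)"
    unfolding approx_double_commutant_epsilon_delta
  proof (intro allI impI)
    fix R \<epsilon> :: real
    assume \<epsilon>: "\<epsilon> > 0"
    then have "\<epsilon> / 2 > 0"
      by simp
    then obtain F \<delta> where F: "finite F" "F \<subseteq> S" "\<delta> > 0" and
      small: "\<And>a. norm a \<le> 4 * R \<Longrightarrow> \<forall>s\<in>F. norm (s * a - a * s) < \<delta> \<Longrightarrow>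
        norm (T * a - a * T) < \<epsilon> / 2"
      using T(1) unfolding approx_double_commutant_epsilon_delta by metis
    show "\<exists>F' \<delta>'. finite F' \<and> F' \<subseteq> \<pi> ` S \<and> \<delta>' > 0 \<and>
      (\<forall>e. norm e \<le> R \<longrightarrow> (\<forall>s\<in>F'. norm (s * e - e * s) < \<delta>') \<longrightarrow> norm (T' * e - e * T') < \<epsilon>)"
    \<comment> \<open>The lift loses a factor \<open>4\<close> and an additive \<open>\<delta> / 2\<close>, and \<open>4 * (\<delta> / 8) + \<delta> / 2 = \<delta>\<close>.\<close>
    proof (intro exI[of _ "\<pi> ` F"] exI[of _ "\<delta> / 8"] conjI allI impI)
      fix e assume e: "norm e \<le> R" "\<forall>s\<in>\<pi> ` F. norm (s * e - e * s) < \<delta> / 8"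
      have "\<delta> / 2 > 0"
        using F(3) by simp
      then obtain a where a: "\<pi> a = e" "norm a \<le> 4 * norm e"
        "\<And>s. s \<in> F \<Longrightarrow> norm (s * a - a * s) \<le> 4 * norm (\<pi> s * e - e * \<pi> s) + \<delta> / 2"
        using almost_commuting_lift[OF assms F(1)] by metis
      have "norm (s * a - a * s) < \<delta>" if "s \<in> F" for s
        using a(3)[OF that] e(2) that by fastforce
      then have "norm (T * a - a * T) < \<epsilon> / 2"
        using a(2) e(1) by (intro small) auto
      then have "norm (\<pi> (T * a - a * T)) < \<epsilon>"
        using unital_star_hom_bounded[OF assms(1), of "T * a - a * T"] by linarith
      then show "norm (T' * e - e * T') < \<epsilon>"
        by (simp add: T(2) a(1))
    qed (use F in auto)
  qed
qed

end
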